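(* For every $C>0$ and every $\epsilon>0$ there is $n_0$ such that for every integer $n>n_0$ and every integer $m$ with $n\le m\le n^{1/\epsilon}$ we have $$m^{2-\epsilon}\le s(n,m)\le \frac{m^2}{C}.$$ (Informally: for $n\le m\le n^{O(1)}$, $s(n,m)=m^2/w(m)$ where $w(m)\to\infty$ and $w(m)$ is smaller than any polynomial in $m$.)
   Context: A hypergraph $H=(V,E)$ consists of a finite vertex set $V$ and a set $E$ of distinct subsets of $V$ (hyperedges). A labeling $f:V\to\mathbb{N}=\{1,2,\dots\}$ is sum-distinguishing if $\sum_{v\in e}f(v)\neq\sum_{v\in e'}f(v)$ for any two distinct hyperedges $e,e'\in E$. Let $s(H)$ be the smallest integer $N$ such that $H$ has a sum-distinguishing labeling with all labels in $\{1,\dots,N\}$. Let $s(n,m)$ be the maximum of $s(H)$ over all hypergraphs $H$ with $n$ vertices and $m$ hyperedges. *)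

theory Defs
  imports Complex_Main "HOL-Library.Nat_Bijection"
begin

definition hypergraph :: "'a set \<Rightarrow> 'a set set \<Rightarrow> bool" where
  "hypergraph V E \<longleftrightarrow> finite V \<and> E \<subseteq> Pow V"

definition sum_distinguishing :: "'a set set \<Rightarrow> ('a \<Rightarrow> nat) \<Rightarrow> bool" where
  "sum_distinguishing E f \<longleftrightarrow>
     (\<forall>e\<in>E. \<forall>e'\<in>E. e \<noteq> e' \<longrightarrow> (\<Sum>v\<in>e. f v) \<noteq> (\<Sum>v\<in>e'. f v))"

definition label_number :: "'a set \<Rightarrow> 'a set set \<Rightarrow> nat" where
  "label_number V E = (LEAST N. \<exists>f. f ` V \<subseteq> {1..N} \<and> sum_distinguishing E f)"

text \<open>Every finite hypergraph is isomorphic to one whose vertices are natural numbers,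
  so it is enough to let the vertex sets range over finite sets of naturals.\<close>

definition max_label_number :: "nat \<Rightarrow> nat \<Rightarrow> nat" where
  "max_label_number n m =
     Max {label_number V E | (V :: nat set) E. hypergraph V E \<and> card V = n \<and> card E = m}"

text \<open>The minimum and the maximum above are attained: labelling the vertices by distinct
  powers of two separates all subsets, and so bounds the label number by \<open>2 ^ card V\<close>.\<close>

lemma power_labeling:
  assumes "hypergraph V E"
  shows "\<exists>f. f ` V \<subseteq> {1..2 ^ card V} \<and> sum_distinguishing E f"
proof -
  have fin: "finite V" and sub: "E \<subseteq> Pow V"
    using assms by (auto simp: hypergraph_def)
  obtain g where g: "bij_betw g V {0..<card V}"
    using ex_bij_betw_finite_nat[OF fin] by blast
  have inj: "inj_on g V" using g by (rule bij_betw_imp_inj_on)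
  have sum_eq: "(\<Sum>v\<in>e. 2 ^ g v) = set_encode (g ` e)" if "e \<subseteq> V" for e
    unfolding set_encode_def
    using sum.reindex[OF inj_on_subset[OF inj that], of "\<lambda>k. 2 ^ k :: nat"] by simp
  have "e = e'" if "e \<in> E" "e' \<in> E" "(\<Sum>v\<in>e. 2 ^ g v :: nat) = (\<Sum>v\<in>e'. 2 ^ g v)" for e e'
  proof -
    have sV: "e \<subseteq> V" "e' \<subseteq> V" using that sub by auto
    then have "finite (g ` e)" "finite (g ` e')"
      using fin by (auto intro: finite_subset)
    then have "g ` e = g ` e'"
      using that(3) sum_eq sV set_encode_eq by metis
    then show ?thesis using inj_on_image_eq_iff[OF inj sV] by simp
  qed
  then have "sum_distinguishing E (\<lambda>v. 2 ^ g v)"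
    unfolding sum_distinguishing_def by blast
  moreover have "(\<lambda>v. 2 ^ g v) ` V \<subseteq> {1..2 ^ card V :: nat}"
    using bij_betwE[OF g] by (force intro!: power_increasing)
  ultimately show ?thesis by blast
qed

lemma label_number_attained:
  assumes "hypergraph V E"
  shows "\<exists>f. f ` V \<subseteq> {1..label_number V E} \<and> sum_distinguishing E f"
  unfolding label_number_def by (rule LeastI, rule power_labeling[OF assms])

lemma label_number_le_power:
  assumes "hypergraph V E"
  shows "label_number V E \<le> 2 ^ card V"
  unfolding label_number_def by (rule Least_le, rule power_labeling[OF assms])

lemma finite_label_numbers:
  "finite {label_number V E | (V :: nat set) E. hypergraph V E \<and> card V = n \<and> card E = m}"
  by (rule finite_subset[of _ "{..2 ^ n}"]) (auto dest: label_number_le_power)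

lemma label_numbers_nonempty:
  assumes "m \<le> 2 ^ n"
  shows "{label_number V E | (V :: nat set) E. hypergraph V E \<and> card V = n \<and> card E = m} \<noteq> {}"
proof -
  have "m \<le> card (Pow {0..<n})" using assms by (simp add: card_Pow)
  then obtain E where "E \<subseteq> Pow {0..<n}" "card E = m"
    by (meson obtain_subset_with_card_n)
  then have "hypergraph {0..<n} E \<and> card {0..<n} = n \<and> card E = m"
    by (simp add: hypergraph_def)
  then show ?thesis by blast
qed

end

(* Upper bound.  Put N = m^2 / C.  Label the vertices by a random low part plus a random multiple
   of N / 2.  Two edges whose difference is large have label sums at distance O(N) only with small
   probability, by the size of the central binomial coefficient, while the expected number of
   conflicting pairs is O(C).  Only boundedly many vertices separate many pairs of edges with a small
   difference, and with positive probability no conflict is supported on these heavy vertices.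
   Hence every conflict contains a light vertex, and relabelling that vertex greedily removes the
   conflict: the forbidden labels come from few close pairs and from the few far pairs whose sums are
   already within O(N), so fewer than N labels are forbidden.

   Lower bound.  Take k of order log m vertices, ignore the others, and choose m of the 2^k subsets
   at random.  A fixed labelling with labels at most N colours the subsets by at most kN + 1 sums;
   by Maclaurin's inequality, m subsets have distinct colours with probability at most
   exp(- m(m-1) / (4(kN + 1))).  For N = m^(2-eps) this beats the number N^k of labellings. *)

theory Submission
  imports Defs "HOL-Library.FuncSet" "HOL-Real_Asymp.Real_Asymp"
begin

section \<open>Lower bound\<close>

text \<open>Elementary symmetric polynomial of degree \<open>m\<close> in the values
  \<open>p x\<close>. When \<open>p x\<close> is the size of colour class \<open>x\<close>, it
  counts the \<open>m\<close>-sets of points with pairwise distinct colours.\<close>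

definition esym :: "('a \<Rightarrow> real) \<Rightarrow> nat \<Rightarrow> 'a set \<Rightarrow> real" where
  "esym p m A = (\<Sum>X | X \<subseteq> A \<and> card X = m. \<Prod>x\<in>X. p x)"

lemma esym_nonneg:
  assumes "\<And>x. x \<in> A \<Longrightarrow> 0 \<le> p x"
  shows "0 \<le> esym p m A"
  unfolding esym_def using assms by (intro sum_nonneg prod_nonneg) auto

lemma esym_0:
  assumes "finite A"
  shows "esym p 0 A = 1"
proof -
  have "{X. X \<subseteq> A \<and> card X = 0} = {{}}"
    using assms by (auto dest: finite_subset)
  then show ?thesis by (simp add: esym_def)
qed

lemma esym_insert:
  assumes "finite A" "a \<notin> A"
  shows "esym p (Suc m) (insert a A) = esym p (Suc m) A + p a * esym p m A"
proof -
  let ?S = "\<lambda>m. {X. X \<subseteq> A \<and> card X = m}"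
  have fin: "finite (?S k)" for k using assms(1) by simp
  have split: "{X. X \<subseteq> insert a A \<and> card X = Suc m} = ?S (Suc m) \<union> insert a ` ?S m" (is "?L = ?R")
  proof
    show "?L \<subseteq> ?R"
    proof
      fix X assume X: "X \<in> ?L"
      show "X \<in> ?R"
      proof (cases "a \<in> X")
        case True
        then have "X = insert a (X - {a})" "X - {a} \<in> ?S m" using X by auto
        then show ?thesis by blast
      qed (use X in auto)
    qed
    show "?R \<subseteq> ?L"
    proof
      fix X assume "X \<in> ?R"
      then consider "X \<in> ?S (Suc m)" | Y where "Y \<in> ?S m" "X = insert a Y" by blast
      then show "X \<in> ?L"
      proof cases
        case 2
        then have "finite Y" "a \<notin> Y" using assms by (auto dest: finite_subset)
        with 2 show ?thesis by auto
      qed auto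
    qed
  qed
  have inj: "inj_on (insert a) (?S m)"
    using assms(2) by (auto simp: inj_on_def)
  have "esym p (Suc m) (insert a A) = esym p (Suc m) A + (\<Sum>X\<in>insert a ` ?S m. \<Prod>x\<in>X. p x)"
    unfolding esym_def split using fin assms(2) by (subst sum.union_disjoint) auto
  also have "(\<Sum>X\<in>insert a ` ?S m. \<Prod>x\<in>X. p x) = (\<Sum>X\<in>?S m. \<Prod>x\<in>insert a X. p x)"
    by (subst sum.reindex[OF inj]) simp
  also have "\<dots> = p a * esym p m A"
    unfolding esym_def sum_distrib_left
  proof (rule sum.cong)
    fix X assume X: "X \<in> ?S m"
    then have "finite X" "a \<notin> X" using assms by (auto dest: finite_subset)
    then show "(\<Prod>x\<in>insert a X. p x) = p a * (\<Prod>x\<in>X. p x)" by simp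
  qed simp
  finally show ?thesis .
qed

lemma esym_empty: "esym p (Suc m) {} = 0"
proof -
  have "{X. X \<subseteq> {} \<and> card X = Suc m} = ({} :: 'a set set)" by auto
  then show ?thesis unfolding esym_def by (metis sum.empty)
qed

lemma esym_remove:
  assumes "finite A" "a \<in> A"
  shows "esym p (Suc m) A = esym p (Suc m) (A - {a}) + p a * esym p m (A - {a})"
  using esym_insert[of "A - {a}" a p m] assms by (simp add: insert_absorb)

text \<open>Both sides count each set \<open>X\<close> of size \<open>m + 1\<close> once for every
  \<open>a \<in> X\<close>. The recursion in \<open>esym_insert\<close> turns this double count into
  an induction over \<open>A\<close>, with \<open>m\<close> kept general.\<close>

lemma esym_Suc:
  assumes "finite A"
  shows "real (Suc m) * esym p (Suc m) A = (\<Sum>a\<in>A. p a * esym p m (A - {a}))"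
  using assms
proof (induction A arbitrary: m rule: finite_induct)
  case empty
  then show ?case by (simp add: esym_empty)
next
  case (insert b A)
  have *: "(\<Sum>a\<in>insert b A. p a * esym p m (insert b A - {a})) =
      p b * esym p m A + (\<Sum>a\<in>A. p a * esym p m (insert b (A - {a})))"
    using insert.hyps by (simp add: insert_Diff_if) (intro sum.cong, auto)
  show ?case
  proof (cases m)
    case 0
    show ?thesis
      using insert.IH[of 0] insert.hyps esym_insert[OF insert.hyps(1,2), of p 0] 
      by (simp add: 0 esym_0)
  next
    case (Suc k)
    have "(\<Sum>a\<in>A. p a * esym p m (insert b (A - {a}))) =
        (\<Sum>a\<in>A. p a * esym p m (A - {a})) + p b * (\<Sum>a\<in>A. p a * esym p k (A - {a}))"
      unfolding sum_distrib_left sum.distrib[symmetric] Suc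
      using insert.hyps by (intro sum.cong) (auto simp: esym_insert algebra_simps)
    then have "(\<Sum>a\<in>A. p a * esym p m (insert b (A - {a}))) =
        real (Suc m) * esym p (Suc m) A + p b * (real m * esym p m A)"
      unfolding insert.IH[symmetric] Suc by simp
    then show ?thesis unfolding * esym_insert[OF insert.hyps(1,2)]
      by (simp add: algebra_simps)
  qed
qed

text \<open>Chebyshev's sum inequality: expand the sum of \<open>(p a - p b) * (w a - w b)\<close>
  over all ordered pairs. Similar ordering is expressed pairwise, which suits an unordered index
  set.\<close>

lemma Chebyshev_sum_set:
  fixes p w :: "'a \<Rightarrow> real"
  assumes "\<And>a b. a \<in> A \<Longrightarrow> b \<in> A \<Longrightarrow> 0 \<le> (p a - p b) * (w a - w b)"
  shows "sum p A * sum w A \<le> real (card A) * (\<Sum>a\<in>A. p a * w a)"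
proof -
  have "0 \<le> (\<Sum>a\<in>A. \<Sum>b\<in>A. (p a - p b) * (w a - w b))"
    using assms by (intro sum_nonneg)
  also have "\<dots> = (\<Sum>a\<in>A. \<Sum>b\<in>A. p a * w a) + (\<Sum>a\<in>A. \<Sum>b\<in>A. p b * w b)
      - (\<Sum>a\<in>A. \<Sum>b\<in>A. p a * w b) - (\<Sum>a\<in>A. \<Sum>b\<in>A. p b * w a)"
    by (simp add: sum.distrib sum_subtractf algebra_simps)
  also have "(\<Sum>a\<in>A. \<Sum>b\<in>A. p b * w a) = (\<Sum>a\<in>A. \<Sum>b\<in>A. p a * w b)"
    by (rule sum.swap)
  also have "(\<Sum>a\<in>A. \<Sum>b\<in>A. p a * w b) = sum p A * sum w A"
    by (simp add: sum_product)
  also have "(\<Sum>a\<in>A. \<Sum>b\<in>A. p b * w b) = real (card A) * (\<Sum>a\<in>A. p a * w a)"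
    by simp
  also have "(\<Sum>a\<in>A. \<Sum>b\<in>A. p a * w a) = real (card A) * (\<Sum>a\<in>A. p a * w a)"
    by (simp add: sum_distrib_left)
  finally show ?thesis by linarith
qed

text \<open>In \<open>esym_Suc\<close>, replace the polynomial over \<open>A - {a}\<close> by the
  one over \<open>A\<close> minus the contribution \<open>w a\<close> of the sets containing
  \<open>a\<close>. The \<open>w a\<close> add up to \<open>real m * esym p m A\<close>, and
  Chebyshev's inequality bounds the subtracted sum of \<open>p a * w a\<close> from below.\<close>

lemma esym_Maclaurin_step:
  assumes fin: "finite A" and ne: "A \<noteq> {}" and pos: "\<And>x. x \<in> A \<Longrightarrow> 0 \<le> p x"
  shows "real (Suc m) * esym p (Suc m) A \<le> (1 - real m / real (card A)) * sum p A * esym p m A"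
proof (cases m)
  case 0
  then show ?thesis using fin by (simp add: esym_Suc esym_0 del: of_nat_Suc)
next
  case (Suc k)
  define w where "w a = p a * esym p k (A - {a})" for a
  have r: "real (card A) > 0" using fin ne by (simp add: card_gt_0_iff)
  have "0 \<le> (p a - p b) * (w a - w b)" if ab: "a \<in> A" "b \<in> A" for a b
  proof (cases "a = b")
    case False
    define B where "B = A - {a} - {b}"
    have B: "finite B" "a \<notin> B" "b \<notin> B" "A - {a} = insert b B" "A - {b} = insert a B"
      using ab False fin by (auto simp: B_def)
    \<comment> \<open>Splitting off \<open>b\<close> in \<open>w a\<close> and \<open>a\<close> in
      \<open>w b\<close> produces the same term with factor \<open>p a * p b\<close>, which cancels;
      hence \<open>w\<close> is ordered like \<open>p\<close>.\<close>
    have "w a - w b = (p a - p b) * esym p k B"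
    proof (cases k)
      case 0
      then show ?thesis using B by (simp add: w_def esym_0)
    next
      case (Suc l)
      then show ?thesis unfolding w_def B using B by (simp add: esym_insert algebra_simps)
    qed
    moreover have "0 \<le> esym p k B" using pos by (intro esym_nonneg) (auto simp: B_def)
    ultimately show ?thesis by (simp add: mult.assoc[symmetric])
  qed simp
  then have cheb: "sum p A * sum w A \<le> real (card A) * (\<Sum>a\<in>A. p a * w a)"
    by (rule Chebyshev_sum_set)
  have sw: "sum w A = real m * esym p m A"
    unfolding w_def Suc by (rule esym_Suc[OF fin, symmetric])
  have "real (Suc m) * esym p (Suc m) A = (\<Sum>a\<in>A. p a * esym p m (A - {a}))"
    by (rule esym_Suc[OF fin])
  also have "\<dots> = (\<Sum>a\<in>A. p a * esym p m A - p a * w a)"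
    using esym_remove[OF fin, of _ p k] by (intro sum.cong) (auto simp: w_def Suc algebra_simps)
  also have "\<dots> = sum p A * esym p m A - (\<Sum>a\<in>A. p a * w a)"
    by (simp add: sum_subtractf sum_distrib_right)
  also have "\<dots> \<le> sum p A * esym p m A - sum p A * sum w A / real (card A)"
    using cheb r by (simp add: field_simps)
  also have "\<dots> = (1 - real m / real (card A)) * sum p A * esym p m A"
    unfolding sw by (simp add: algebra_simps)
  finally show ?thesis .
qed

text \<open>Going from \<open>m\<close> to \<open>m + 1\<close>, the Maclaurin step multiplies by at
  most \<open>(1 - m / r) * T / (m + 1)\<close>, with \<open>r = card R\<close>, whereas the
  binomial coefficient grows by \<open>(T - m) / (m + 1)\<close>. For \<open>T \<ge> 2 * r\<close>
  the quotient of these factors is at most \<open>1 - m / (2 * r)\<close>, hence at most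
  \<open>exp (- m / (2 * r))\<close>.\<close>

lemma esym_le_binomial:
  assumes fin: "finite R" and ne: "R \<noteq> {}" and pos: "\<And>x. x \<in> R \<Longrightarrow> 0 \<le> p x"
    and sum_p: "sum p R = real T" and T: "2 * card R \<le> T"
  shows "esym p m R \<le> real (T choose m) * exp (- (\<Sum>i<m. real i / (2 * real (card R))))"
proof (induction m)
  case 0
  then show ?case by (simp add: esym_0 fin)
next
  case (Suc m)
  let ?r = "real (card R)"
  let ?x = "exp (- (\<Sum>i<m. real i / (2 * ?r)))"
  have r: "?r > 0" using fin ne by (simp add: card_gt_0_iff)
  have step: "real (Suc m) * esym p (Suc m) R \<le> (1 - real m / ?r) * real T * esym p m R"
    using esym_Maclaurin_step[OF fin ne, of p m] pos sum_p by simp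
  have e0: "0 \<le> esym p m R" by (intro esym_nonneg pos)
  show ?case
  proof (cases "m \<le> card R")
    case False
    then have "1 - real m / ?r \<le> 0" using r by (simp add: field_simps)
    then have "(1 - real m / ?r) * real T * esym p m R \<le> 0"
      using e0 by (intro mult_nonpos_nonneg) (auto intro: mult_nonpos_nonneg)
    then have "real (Suc m) * esym p (Suc m) R \<le> 0" using step by linarith
    then have "esym p (Suc m) R \<le> 0" by (simp add: mult_le_0_iff)
    also have "0 \<le> real (T choose Suc m) * exp (- (\<Sum>i<Suc m. real i / (2 * ?r)))" by simp
    finally show ?thesis .
  next
    case True
    have mT: "m \<le> T" using True T by linarith
    \<comment> \<open>The required inequality has right side minus left side equal to
      \<open>u - m + m * m / (2 * r)\<close>, and \<open>T \<ge> 2 * r\<close> gives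
      \<open>u \<ge> m\<close>.\<close>
    define u where "u = real T * real m / (2 * ?r)"
    have "real m \<le> u"
      using T r mult_right_mono[of "2 * ?r" "real T" "real m"] by (simp add: u_def field_simps)
    moreover have "(1 - real m / ?r) * real T = real T - 2 * u"
      using r by (simp add: u_def field_simps)
    moreover have "(real T - real m) * (1 - real m / (2 * ?r)) =
        real T - real m - u + real m * real m / (2 * ?r)"
      using r by (simp add: u_def field_simps)
    moreover have "0 \<le> real m * real m / (2 * ?r)" by simp
    ultimately have "(1 - real m / ?r) * real T \<le> (real T - real m) * (1 - real m / (2 * ?r))"
      by linarith
    also have "\<dots> \<le> (real T - real m) * exp (- (real m / (2 * ?r)))"
      using mT exp_ge_add_one_self[of "- (real m / (2 * ?r))"] by (intro mult_left_mono) auto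
    finally have a: "(1 - real m / ?r) * real T \<le> (real T - real m) * exp (- (real m / (2 * ?r)))" .
    have "real (Suc m) * esym p (Suc m) R \<le>
        ((real T - real m) * exp (- (real m / (2 * ?r)))) * (real (T choose m) * ?x)"
      using step mult_mono[OF a Suc.IH _ e0] mT by simp
    also have "\<dots> = ((real T - real m) * real (T choose m)) * exp (- (\<Sum>i<Suc m. real i / (2 * ?r)))"
      by (simp add: exp_diff exp_minus field_simps)
    also have "(real T - real m) * real (T choose m) = real (Suc m) * real (T choose Suc m)"
      using binomial_absorb_comp[of T m] mT
      by (metis Suc_times_binomial_eq binomial_absorption binomial_absorb_comp of_nat_diff of_nat_mult
          times_binomial_minus1_eq)
    finally show ?thesis by (simp add: mult.assoc del: of_nat_Suc)
  qed
qed

section \<open>Counting rainbow sets of a coloured ground set\<close>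

text \<open>A set on which the colouring is injective is determined by its set \<open>X\<close> of
  colours and the choice of one point from each class in \<open>X\<close>; there are as many choices
  as the product of the class sizes.\<close>

lemma card_rainbow_le_esym:
  assumes fin: "finite \<Omega>" "finite R" and c: "c ` \<Omega> \<subseteq> R"
  shows "real (card {E. E \<subseteq> \<Omega> \<and> card E = m \<and> inj_on c E})
     \<le> esym (\<lambda>x. real (card {y \<in> \<Omega>. c y = x})) m R"
proof -
  let ?G = "{E. E \<subseteq> \<Omega> \<and> card E = m \<and> inj_on c E}"
  let ?F = "\<lambda>x. {y \<in> \<Omega>. c y = x}"
  let ?S = "SIGMA X : {X. X \<subseteq> R \<and> card X = m}. PiE X ?F"
  \<comment> \<open>The image of the second component is \<open>E\<close> again, so \<open>h\<close>
    is injective on the rainbow sets.\<close>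
  define h where "h E = (c ` E, restrict (the_inv_into E c) (c ` E))" for E
  have finR: "finite X" if "X \<subseteq> R" for X using that fin(2) by (rule finite_subset)
  have finS: "finite ?S" using fin finR by (intro finite_SigmaI finite_PiE) auto
  have recover: "snd (h E) ` fst (h E) = E" if "inj_on c E" for E
    using that by (simp add: h_def image_image the_inv_into_f_f)
  have "inj_on h ?G"
    by (rule inj_on_inverseI[of _ "\<lambda>q. snd q ` fst q"]) (use recover in auto)
  moreover have "h ` ?G \<subseteq> ?S"
  proof
    fix q assume "q \<in> h ` ?G"
    then obtain E where E: "E \<subseteq> \<Omega>" "card E = m" "inj_on c E" "q = h E" by auto
    have "restrict (the_inv_into E c) (c ` E) \<in> PiE (c ` E) ?F"
      using E(1,3) by (fastforce simp: the_inv_into_f_f PiE_iff)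
    moreover have "c ` E \<subseteq> R" "card (c ` E) = m" using E c by (auto simp: card_image)
    ultimately show "q \<in> ?S" unfolding E(4) h_def by blast
  qed
  ultimately have "card ?G \<le> card ?S"
    by (rule card_inj_on_le[OF _ _ finS])
  also have "\<dots> = (\<Sum>X | X \<subseteq> R \<and> card X = m. card (PiE X ?F))"
    using fin finR by (intro card_SigmaI ballI finite_PiE) auto
  also have "\<dots> = (\<Sum>X | X \<subseteq> R \<and> card X = m. \<Prod>x\<in>X. card (?F x))"
    using finR by (intro sum.cong) (auto simp: card_PiE)
  finally have "real (card ?G) \<le> real (\<Sum>X | X \<subseteq> R \<and> card X = m. \<Prod>x\<in>X. card (?F x))"
    by (simp only: of_nat_le_iff)
  then show ?thesis by (simp add: esym_def)
qed

lemma sum_lessThan_real: "(\<Sum>i<m. real i) = real m * (real m - 1) / 2"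
  by (induction m) (auto simp: field_simps)

lemma card_rainbow_le_exp:
  assumes fin: "finite \<Omega>" "finite R" and ne: "R \<noteq> {}" and c: "c ` \<Omega> \<subseteq> R"
    and T: "2 * card R \<le> card \<Omega>"
  shows "real (card {E. E \<subseteq> \<Omega> \<and> card E = m \<and> inj_on c E})
     \<le> real (card \<Omega> choose m) * exp (- (real m * (real m - 1) / (4 * real (card R))))"
proof -
  have "(\<Sum>x\<in>R. card {y \<in> \<Omega>. c y = x}) = card \<Omega>"
    using sum.group[OF fin c, of "\<lambda>_. 1::nat"] by simp
  then have "(\<Sum>x\<in>R. real (card {y \<in> \<Omega>. c y = x})) = real (card \<Omega>)"
    by (metis of_nat_sum)
  from esym_le_binomial[OF fin(2) ne _ this T, of m]
  have "esym (\<lambda>x. real (card {y \<in> \<Omega>. c y = x})) m R \<le>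
      real (card \<Omega> choose m) * exp (- (\<Sum>i<m. real i / (2 * real (card R))))" by simp
  also have "(\<Sum>i<m. real i / (2 * real (card R))) = real m * (real m - 1) / (4 * real (card R))"
    by (simp add: sum_divide_distrib[symmetric] sum_lessThan_real)
  finally show ?thesis using card_rainbow_le_esym[OF fin c, of m] by linarith
qed

section \<open>The lower bound by a union bound over labellings\<close>

text \<open>The vertex sums of a labelling of \<open>k\<close> vertices by \<open>1..N\<close>
  colour the \<open>2 ^ k\<close> subsets with colours from \<open>{..k * N}\<close>, and the
  labelling distinguishes exactly the rainbow families. By \<open>small\<close>, the families
  distinguished by one of the \<open>N ^ k\<close> labellings do not exhaust all
  \<open>m\<close>-element families.\<close>

lemma exists_hypergraph_large_label_number:
  assumes k: "k \<le> n" and T: "2 * (k * N + 1) \<le> 2 ^ k" and m: "m \<le> 2 ^ k"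
    and small: "real N ^ k * exp (- (real m * (real m - 1) / (4 * (real k * real N + 1)))) < 1"
  obtains E where "hypergraph {..<n} E" "card E = m" "N < label_number {..<n} E"
proof -
  let ?\<Omega> = "Pow {..<k}"
  let ?L = "PiE {..<k} (\<lambda>_. {1..N})"
  let ?c = "\<lambda>f e. \<Sum>v\<in>e. f v :: nat"
  let ?G = "\<lambda>f. {E. E \<subseteq> ?\<Omega> \<and> card E = m \<and> inj_on (?c f) E}"
  let ?A = "{E. E \<subseteq> ?\<Omega> \<and> card E = m}"
  have cA: "card ?A = (2 ^ k choose m)"
    using n_subsets[of ?\<Omega> m] by (simp add: card_Pow)
  have G: "real (card (?G f)) \<le> real (2 ^ k choose m) *
      exp (- (real m * (real m - 1) / (4 * (real k * real N + 1))))" if f: "f \<in> ?L" for f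
  proof -
    have "?c f ` ?\<Omega> \<subseteq> {..k * N}"
    proof (rule image_subsetI)
      fix e assume "e \<in> ?\<Omega>"
      then have e: "e \<subseteq> {..<k}" by simp
      have "?c f e \<le> (\<Sum>v\<in>e. N)" using f e by (intro sum_mono) (auto simp: PiE_iff)
      also have "\<dots> \<le> k * N" using card_mono[OF _ e] by simp
      finally show "?c f e \<in> {..k * N}" by simp
    qed
    from card_rainbow_le_exp[OF _ _ _ this, of m] T show ?thesis
      by (simp add: card_Pow algebra_simps)
  qed
  have "real (card (\<Union>f\<in>?L. ?G f)) \<le> (\<Sum>f\<in>?L. real (card (?G f)))"
    using card_UN_le[of ?L ?G] by (simp add: finite_PiE flip: of_nat_sum)
  also have "\<dots> \<le> (\<Sum>f\<in>?L. real (2 ^ k choose m) *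
      exp (- (real m * (real m - 1) / (4 * (real k * real N + 1)))))"
    by (intro sum_mono G)
  also have "\<dots> = real (2 ^ k choose m) *
      (real N ^ k * exp (- (real m * (real m - 1) / (4 * (real k * real N + 1)))))"
    by (simp add: card_PiE)
  also have "\<dots> < real (2 ^ k choose m)"
    using small m by (simp add: zero_less_binomial)
  finally have "card (\<Union>f\<in>?L. ?G f) < card ?A" unfolding cA by linarith
  then have "\<not> ?A \<subseteq> (\<Union>f\<in>?L. ?G f)"
    using card_mono[of "\<Union>f\<in>?L. ?G f" ?A] by (auto simp: finite_PiE not_le[symmetric])
  then obtain E where E: "E \<subseteq> ?\<Omega>" "card E = m" and bad: "\<And>f. f \<in> ?L \<Longrightarrow> \<not> inj_on (?c f) E"
    by blast
  \<comment> \<open>The vertices from \<open>k\<close> to \<open>n - 1\<close> lie in no edge, so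
    restricting a labelling to \<open>{..<k}\<close> changes no edge sum.\<close>
  have hyp: "hypergraph {..<n} E" using E k by (fastforce simp: hypergraph_def)
  obtain f where f: "f ` {..<n} \<subseteq> {1..label_number {..<n} E}" "sum_distinguishing E f"
    using label_number_attained[OF hyp] by blast
  have "N < label_number {..<n} E"
  proof (rule ccontr)
    assume le: "\<not> N < label_number {..<n} E"
    have "f v \<in> {1..N}" if "v < k" for v
    proof -
      have "f v \<in> {1..label_number {..<n} E}" using f(1) k that by (simp add: image_subset_iff)
      then show ?thesis using le by simp
    qed
    then have "restrict f {..<k} \<in> ?L" by simp
    moreover have "?c (restrict f {..<k}) e = ?c f e" if "e \<in> E" for e
      using that E by (intro sum.cong) auto
    then have "inj_on (?c (restrict f {..<k})) E"
      using f(2) unfolding sum_distinguishing_def inj_on_def by metis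
    ultimately show False using bad by blast
  qed
  with hyp E(2) that show thesis by blast
qed

lemma label_number_le_max:
  assumes "hypergraph (V :: nat set) E" "card V = n" "card E = m"
  shows "label_number V E \<le> max_label_number n m"
  unfolding max_label_number_def using assms by (intro Max_ge[OF finite_label_numbers]) blast

lemma max_label_number_lower:
  fixes \<epsilon> :: real
  assumes eps: "0 < \<epsilon>" "\<epsilon> < 1"
  shows "\<exists>n0. \<forall>n>n0. \<forall>m. n \<le> m \<and> real m \<le> real n powr (1 / \<epsilon>) \<longrightarrow>
    real m powr (2 - \<epsilon>) \<le> real (max_label_number n m)"
proof -
  \<comment> \<open>The three conditions say, in order, that there are twice as many subsets as
    colours, that the exponential beats the number of labellings, and that \<open>k \<le> n\<close>.
    The first two are used at \<open>x = m\<close>, the last at \<open>x = n\<close>.\<close>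
  have "\<forall>\<^sub>F x :: real in at_top. 2 * ((4 * log 2 x + 1) * x powr (2 - \<epsilon>) + 1) \<le> x ^ 4 \<and>
      (4 * log 2 x + 1) * (2 * ln x) <
         x * (x - 1) / (4 * ((4 * log 2 x + 1) * x powr (2 - \<epsilon>) + 1)) \<and>
      4 * (log 2 x / \<epsilon>) + 1 \<le> x"
    using eps by (intro eventually_conj; real_asymp)
  then obtain x0 where
    x0: "\<And>x. x \<ge> x0 \<Longrightarrow> 2 * ((4 * log 2 x + 1) * x powr (2 - \<epsilon>) + 1) \<le> x ^ 4"
      "\<And>x. x \<ge> x0 \<Longrightarrow> (4 * log 2 x + 1) * (2 * ln x) <
         x * (x - 1) / (4 * ((4 * log 2 x + 1) * x powr (2 - \<epsilon>) + 1))"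
      "\<And>x. x \<ge> x0 \<Longrightarrow> 4 * (log 2 x / \<epsilon>) + 1 \<le> x"
    unfolding eventually_at_top_linorder by blast
  show ?thesis
  proof (intro exI[of _ "nat \<lceil>max x0 2\<rceil>"] allI impI)
    fix n m :: nat
    assume n: "nat \<lceil>max x0 2\<rceil> < n" and m: "n \<le> m \<and> real m \<le> real n powr (1 / \<epsilon>)"
    define x where "x = real m"
    \<comment> \<open>This makes \<open>2 ^ k\<close> at least \<open>m ^ 4\<close>, far above the
      \<open>k * N + 1\<close> possible sums, while \<open>k\<close> stays logarithmic in
      \<open>m\<close>.\<close>
    define k where "k = nat \<lceil>4 * log 2 x\<rceil>"
    define N where "N = nat \<lfloor>x powr (2 - \<epsilon>)\<rfloor>"
    have n': "real n \<ge> x0" "real n \<ge> 2" using n by linarith+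
    have x: "x \<ge> x0" "x \<ge> 2" using n' m by (auto simp: x_def)
    have log0: "log 2 x \<ge> 0" using x by simp
    have k: "4 * log 2 x \<le> real k" "real k \<le> 4 * log 2 x + 1"
      using log0 unfolding k_def by linarith+
    have N: "1 \<le> real N" "real N \<le> x powr (2 - \<epsilon>)" "x powr (2 - \<epsilon>) < real N + 1"
    proof -
      have "1 \<le> x powr (2 - \<epsilon>)" using x eps by (intro ge_one_powr_ge_zero) auto
      then have "1 \<le> \<lfloor>x powr (2 - \<epsilon>)\<rfloor>" by simp
      then have "real N = real_of_int \<lfloor>x powr (2 - \<epsilon>)\<rfloor>" "1 \<le> real_of_int \<lfloor>x powr (2 - \<epsilon>)\<rfloor>"
        unfolding N_def by (simp, linarith)
      then show "1 \<le> real N" "real N \<le> x powr (2 - \<epsilon>)" "x powr (2 - \<epsilon>) < real N + 1"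
        by linarith+
    qed
    have kN: "real k * real N \<le> (4 * log 2 x + 1) * x powr (2 - \<epsilon>)"
      using k N log0 by (intro mult_mono) auto
    have "x ^ 4 = 2 powr (4 * log 2 x)"
      using x by (simp add: powr_powr[symmetric] powr_realpow mult.commute[of 4])
    also have "\<dots> \<le> 2 powr real k" using k by simp
    finally have xk: "x ^ 4 \<le> 2 ^ k" by (simp add: powr_realpow)
    have "2 * (real k * real N + 1) \<le> 2 * ((4 * log 2 x + 1) * x powr (2 - \<epsilon>) + 1)"
      using kN by simp
    also have "\<dots> \<le> 2 ^ k" using x0(1)[OF x(1)] xk by (rule order_trans)
    finally have "2 * (real k * real N + 1) \<le> 2 ^ k" .
    then have "real (2 * (k * N + 1)) \<le> real (2 ^ k)" by simp
    then have T: "2 * (k * N + 1) \<le> 2 ^ k" by (simp only: of_nat_le_iff)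
    have "x \<le> x ^ 4" using x self_le_power[of x 4] by simp
    then have "x \<le> 2 ^ k" using xk by (rule order_trans)
    then have "real m \<le> real (2 ^ k)" by (simp add: x_def)
    then have mk: "m \<le> 2 ^ k" by (simp only: of_nat_le_iff)
    have "log 2 x \<le> log 2 (real n powr (1 / \<epsilon>))" using m x by (intro log_mono) (simp_all add: x_def)
    also have "\<dots> = log 2 (real n) / \<epsilon>" using n' by (simp add: log_powr)
    finally have "real k \<le> real n" using k x0(3)[OF n'(1)] by linarith
    then have kn: "k \<le> n" by simp
    have "ln (real N) \<le> ln (x powr (2 - \<epsilon>))" using N by (intro ln_mono) simp_all
    also have "\<dots> = (2 - \<epsilon>) * ln x" using x by (simp add: ln_powr)
    also have "\<dots> \<le> 2 * ln x" using eps x by (intro mult_right_mono) auto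
    finally have "real k * ln (real N) \<le> (4 * log 2 x + 1) * (2 * ln x)"
      using k log0 N by (intro mult_mono) auto
    also have "\<dots> < x * (x - 1) / (4 * ((4 * log 2 x + 1) * x powr (2 - \<epsilon>) + 1))"
      by (rule x0(2)[OF x(1)])
    also have "\<dots> \<le> x * (x - 1) / (4 * (real k * real N + 1))"
      using kN x by (intro divide_left_mono mult_pos_pos) (auto intro!: add_nonneg_pos)
    finally have less: "real k * ln (real N) < x * (x - 1) / (4 * (real k * real N + 1))" .
    have "real N ^ k = exp (real k * ln (real N))"
      using N by (simp add: exp_of_nat_mult)
    then have "real N ^ k * exp (- (x * (x - 1) / (4 * (real k * real N + 1)))) < 1"
      using less by (simp flip: exp_add)
    then obtain E where E: "hypergraph {..<n} E" "card E = m" "N < label_number {..<n} E"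
      using exists_hypergraph_large_label_number[OF kn T mk] unfolding x_def by blast
    \<comment> \<open>The strict inequality absorbs the rounding: the maximum is at least
      \<open>N + 1\<close>, which exceeds \<open>x powr (2 - \<epsilon>)\<close>.\<close>
    then have "N < max_label_number n m" using label_number_le_max[OF E(1) _ E(2)] by fastforce
    then show "real m powr (2 - \<epsilon>) \<le> real (max_label_number n m)"
      using N(3) unfolding x_def by linarith
  qed
qed

section \<open>Upper bound\<close>

text \<open>The other coordinates determine \<open>a v\<close>, because
  \<open>s v \<noteq> 0\<close>. Overwriting it by any \<open>j\<close> in \<open>{1..M}\<close> is
  therefore injective on pairs of a solution and a \<open>j\<close>. So a random low part solves the
  equation with probability at most \<open>1 / M\<close>, whatever the shift
  \<open>b\<close>.\<close>

lemma card_solutions_le: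
  fixes s b :: "'a \<Rightarrow> int"
  assumes fin: "finite V" and v: "v \<in> V" "s v \<noteq> 0"
  shows "card {a \<in> PiE V (\<lambda>_. {1..M}). (\<Sum>u\<in>V. s u * (int (a u) + b u)) = 0} * M \<le> M ^ card V"
proof -
  let ?C = "{a \<in> PiE V (\<lambda>_. {1..M}). (\<Sum>u\<in>V. s u * (int (a u) + b u)) = 0}"
  let ?g = "\<lambda>(a, j). a(v := j)"
  have "inj_on ?g (?C \<times> {1..M})"
  proof (rule inj_onI, clarify)
    fix a j a' j'
    assume a: "a \<in> PiE V (\<lambda>_. {1..M})" "(\<Sum>u\<in>V. s u * (int (a u) + b u)) = 0"
      and a': "a' \<in> PiE V (\<lambda>_. {1..M})" "(\<Sum>u\<in>V. s u * (int (a' u) + b u)) = 0"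
      and eq: "a(v := j) = a'(v := j')"
    have other: "a u = a' u" if "u \<noteq> v" for u using fun_cong[OF eq, of u] that by simp
    have "(\<Sum>u\<in>V - {v}. s u * (int (a u) + b u)) = (\<Sum>u\<in>V - {v}. s u * (int (a' u) + b u))"
      using other by (intro sum.cong) auto
    then have "s v * (int (a v) + b v) = s v * (int (a' v) + b v)"
      using a(2) a'(2) unfolding sum.remove[OF fin v(1)] by linarith
    then have "a v = a' v" using v(2) by simp
    then have "a = a'" using other by (metis ext)
    moreover have "j = j'" using fun_cong[OF eq, of v] by simp
    ultimately show "a = a' \<and> j = j'" by simp
  qed
  moreover have "?g ` (?C \<times> {1..M}) \<subseteq> PiE V (\<lambda>_. {1..M})"
    using v(1) by (auto simp: PiE_iff extensional_def)
  moreover have "finite (PiE V (\<lambda>_. {1..M}))" using fin by (intro finite_PiE) auto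
  ultimately have "card (?C \<times> {1..M}) \<le> card (PiE V (\<lambda>_. {1..M}))"
    by (rule card_inj_on_le)
  then show ?thesis using fin by (simp add: card_PiE card_cartesian_product)
qed

text \<open>A Littlewood-Offord type bound. The signed sum over \<open>Y\<close> is, up to a
  constant, the size of the flipped set; only \<open>2 * L + 1\<close> sizes are admissible, and no
  layer of the cube exceeds the central binomial coefficient.\<close>

lemma card_signed_sums_near_le:
  fixes s :: "'a \<Rightarrow> int" and c :: int
  assumes card: "card S = 2 * q" and fin: "finite S" and M: "0 < M"
    and s: "\<And>y. y \<in> S \<Longrightarrow> s y = 1 \<or> s y = -1"
  shows "card {Y \<in> Pow S. \<bar>c + int M * (\<Sum>y\<in>Y. s y)\<bar> \<le> int L * int M}
    \<le> (2 * L + 1) * (2 * q choose q)"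
proof -
  let ?A = "{Y \<in> Pow S. \<bar>c + int M * (\<Sum>y\<in>Y. s y)\<bar> \<le> int L * int M}"
  define B where "B = {y \<in> S. s y = -1}"
  \<comment> \<open>flipping the negative elements turns the signed sum into a cardinality, up to a constant\<close>
  define flip where "flip Y = (Y - B) \<union> (B - Y)" for Y
  define J where "J = {j. j \<le> 2 * q \<and> \<bar>c + int M * (int j - int (card B))\<bar> \<le> int L * int M}"
  have finB: "finite B" "B \<subseteq> S" using fin by (auto simp: B_def)
  have finJ: "finite J" by (rule finite_subset[of _ "{..2 * q}"]) (auto simp: J_def)
  have sum_eq: "(\<Sum>y\<in>Y. s y) = int (card (flip Y)) - int (card B)" if Y: "Y \<subseteq> S" for Y
  proof -
    have finY: "finite Y" using Y fin by (rule finite_subset)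
    have "(\<Sum>y\<in>Y. s y) = (\<Sum>y\<in>Y - B. s y) + (\<Sum>y\<in>Y \<inter> B. s y)"
      using finY by (metis Int_commute Diff_Int_distrib2 sum.Int_Diff add.commute)
    also have "(\<Sum>y\<in>Y - B. s y) = (\<Sum>y\<in>Y - B. 1)"
      using Y s by (intro sum.cong) (auto simp: B_def)
    also have "(\<Sum>y\<in>Y \<inter> B. s y) = (\<Sum>y\<in>Y \<inter> B. -1)"
      by (intro sum.cong) (auto simp: B_def)
    finally have 1: "(\<Sum>y\<in>Y. s y) = int (card (Y - B)) - int (card (Y \<inter> B))" by simp
    have 2: "card (flip Y) = card (Y - B) + card (B - Y)"
      unfolding flip_def using finY finB by (intro card_Un_disjoint) auto
    have 3: "card B = card (B - Y) + card (Y \<inter> B)"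
      using finB(1) by (metis Int_commute card_Diff_subset_Int card_mono finite_Int inf_le1 le_add_diff_inverse2)
    show ?thesis using 1 2 3 by simp
  qed
  have inj: "inj_on flip ?A"
    by (rule inj_on_inverseI[of _ flip]) (auto simp: flip_def)
  have sub: "flip ` ?A \<subseteq> (\<Union>j\<in>J. {Z. Z \<subseteq> S \<and> card Z = j})"
  proof (rule image_subsetI)
    fix Y assume Y: "Y \<in> ?A"
    have "flip Y \<subseteq> S" using Y finB by (auto simp: flip_def)
    moreover from this have "card (flip Y) \<le> 2 * q" using card_mono[OF fin] card by metis
    ultimately show "flip Y \<in> (\<Union>j\<in>J. {Z. Z \<subseteq> S \<and> card Z = j})"
      using Y sum_eq[of Y] by (auto simp: J_def)
  qed
  \<comment> \<open>Two members of \<open>J\<close> give values within \<open>2 * L * M\<close> of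
    each other, so they differ by at most \<open>2 * L\<close>.\<close>
  have "card J \<le> 2 * L + 1"
  proof (cases "J = {}")
    case False
    have "j \<le> Min J + 2 * L" if j: "j \<in> J" for j
    proof -
      have "\<bar>c + int M * (int (Min J) - int (card B))\<bar> \<le> int L * int M"
        "\<bar>c + int M * (int j - int (card B))\<bar> \<le> int L * int M"
        using Min_in[OF finJ False] j by (auto simp: J_def)
      then have "int M * (int j - int (Min J)) \<le> int M * (2 * int L)"
        by (simp add: algebra_simps)
      then show ?thesis using M by simp
    qed
    then have "J \<subseteq> {Min J..Min J + 2 * L}" using finJ by auto
    then show ?thesis using card_mono[of "{Min J..Min J + 2 * L}" J] by simp
  qed simp
  have "card ?A \<le> card (\<Union>j\<in>J. {Z. Z \<subseteq> S \<and> card Z = j})"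
    by (rule card_inj_on_le[OF inj sub]) (use finJ fin in auto)
  also have "\<dots> \<le> (\<Sum>j\<in>J. card {Z. Z \<subseteq> S \<and> card Z = j})"
    by (rule card_UN_le[OF finJ])
  also have "\<dots> \<le> (\<Sum>j\<in>J. 2 * q choose q)"
    using n_subsets[OF fin] card by (intro sum_mono) (simp add: binomial_maximum')
  also have "\<dots> \<le> (2 * L + 1) * (2 * q choose q)"
    using mult_le_mono1[OF \<open>card J \<le> 2 * L + 1\<close>] by simp
  finally show ?thesis .
qed

text \<open>Fix the part of \<open>X\<close> outside a \<open>2 * q\<close>-element set
  \<open>S\<close> on which \<open>s\<close> is nonzero, and apply the previous bound to the random
  part inside \<open>S\<close>. The factor \<open>4 ^ q\<close> is the number of subsets of
  \<open>S\<close>.\<close>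

lemma card_near_le:
  fixes s w :: "'a \<Rightarrow> int"
  assumes fin: "finite V" and M: "0 < M" and s: "\<And>v. v \<in> V \<Longrightarrow> s v \<in> {-1, 0, 1}"
    and supp: "2 * q \<le> card {v \<in> V. s v \<noteq> 0}"
  shows "card {X \<in> Pow V. \<bar>\<Sum>v\<in>V. s v * (w v + int M * of_bool (v \<in> X))\<bar> \<le> int L * int M} * 4 ^ q
    \<le> (2 * L + 1) * (2 * q choose q) * 2 ^ card V"
proof -
  let ?D = "\<lambda>X. \<Sum>v\<in>V. s v * (w v + int M * of_bool (v \<in> X))"
  let ?A = "{X \<in> Pow V. \<bar>?D X\<bar> \<le> int L * int M}"
  obtain S where S: "S \<subseteq> {v \<in> V. s v \<noteq> 0}" "card S = 2 * q" "finite S"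
    using obtain_subset_with_card_n[OF supp] by blast
  have SV: "S \<subseteq> V" using S by auto
  have s1: "s y = 1 \<or> s y = -1" if "y \<in> S" for y using that S(1) s[of y] by auto
  let ?Y = "\<lambda>Z. {Y \<in> Pow S. \<bar>?D Z + int M * (\<Sum>y\<in>Y. s y)\<bar> \<le> int L * int M}"
  have finY: "finite (?Y Z)" for Z using S(3) by simp
  have finS: "finite (SIGMA Z : Pow (V - S). ?Y Z)"
    using fin S(3) by (intro finite_SigmaI) auto
  have D_split: "?D X = ?D (X - S) + int M * (\<Sum>y\<in>X \<inter> S. s y)" if "X \<subseteq> V" for X
  proof -
    have "(\<Sum>y\<in>X \<inter> S. s y) = (\<Sum>v\<in>V. s v * of_bool (v \<in> X \<inter> S))"
      using fin that by (intro sum.mono_neutral_cong_left) auto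
    then have "?D (X - S) + int M * (\<Sum>y\<in>X \<inter> S. s y) =
        (\<Sum>v\<in>V. s v * (w v + int M * of_bool (v \<in> X - S)) + int M * (s v * of_bool (v \<in> X \<inter> S)))"
      by (simp only: sum_distrib_left sum.distrib)
    also have "\<dots> = ?D X"
      by (intro sum.cong) (auto simp: algebra_simps)
    finally show ?thesis by simp
  qed
  have "?A \<subseteq> (\<lambda>(Z, Y). Z \<union> Y) ` (SIGMA Z : Pow (V - S). ?Y Z)"
  proof
    fix X assume X: "X \<in> ?A"
    then have XV: "X \<subseteq> V" and near: "\<bar>?D X\<bar> \<le> int L * int M" by simp_all
    have "\<bar>?D (X - S) + int M * (\<Sum>y\<in>X \<inter> S. s y)\<bar> \<le> int L * int M"
      using near unfolding D_split[OF XV] .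
    then have "(X - S, X \<inter> S) \<in> (SIGMA Z : Pow (V - S). ?Y Z)"
      using XV by (intro SigmaI PowI CollectI conjI) (blast, blast)
    moreover have "X = (\<lambda>(Z, Y). Z \<union> Y) (X - S, X \<inter> S)"
      unfolding case_prod_conv by blast
    ultimately show "X \<in> (\<lambda>(Z, Y). Z \<union> Y) ` (SIGMA Z : Pow (V - S). ?Y Z)"
      by (rule rev_image_eqI)
  qed
  then have "card ?A \<le> card (SIGMA Z : Pow (V - S). ?Y Z)"
    by (rule surj_card_le[OF finS])
  also have "\<dots> = (\<Sum>Z\<in>Pow (V - S). card (?Y Z))"
    using fin finY by (intro card_SigmaI) auto
  also have "\<dots> \<le> (\<Sum>Z\<in>Pow (V - S). (2 * L + 1) * (2 * q choose q))"
    by (intro sum_mono card_signed_sums_near_le S M s1)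
  also have "\<dots> = (2 * L + 1) * (2 * q choose q) * 2 ^ (card V - 2 * q)"
    using fin S SV by (simp add: card_Pow card_Diff_subset)
  finally have "card ?A * 4 ^ q \<le> (2 * L + 1) * (2 * q choose q) * 2 ^ (card V - 2 * q) * 4 ^ q"
    by simp
  also have "(4::nat) ^ q = 2 ^ (2 * q)" by (simp add: power_mult)
  also have "(2 * L + 1) * (2 * q choose q) * 2 ^ (card V - 2 * q) * 2 ^ (2 * q) =
      (2 * L + 1) * (2 * q choose q) * 2 ^ card V"
    using card_mono[OF fin SV] S(2) by (simp flip: power_add add: mult.assoc)
  finally show ?thesis by (simp add: power_mult)
qed

text \<open>This is the bound \<open>4 ^ q / sqrt (2 * q + 1)\<close> for the central binomial
  coefficient, squared to stay within the naturals. The induction step reduces to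
  \<open>(2 * q + 1) * (2 * q + 3) \<le> 4 * (q + 1) * (q + 1)\<close>.\<close>

lemma central_binomial_sq_le: "(2 * q choose q)\<^sup>2 * (2 * q + 1) \<le> 16 ^ q"
proof (induction q)
  case (Suc q)
  let ?b = "2 * q choose q" and ?c = "2 * Suc q choose Suc q"
  have "Suc q * ?c = 2 * (2 * q + 1) * ?b"
  proof -
    have "Suc q * (2 * q + 1 choose Suc q) = (2 * q + 1) * ?b"
      using Suc_times_binomial[of q "2 * q"] by (simp del: binomial_Suc_Suc)
    moreover have "2 * q + 1 choose Suc q = 2 * q + 1 choose q"
      using binomial_symmetric[of q "2 * q + 1"] by (simp del: binomial_Suc_Suc)
    moreover have "Suc q * ?c = 2 * (Suc q * (2 * q + 1 choose q))"
      using Suc_times_binomial[of q "2 * q + 1"] by (simp del: binomial_Suc_Suc add: algebra_simps)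
    ultimately show ?thesis by (simp only: mult.assoc)
  qed
  then have "(Suc q)\<^sup>2 * ?c\<^sup>2 = (2 * (2 * q + 1) * ?b)\<^sup>2" by (metis power_mult_distrib)
  then have "(Suc q)\<^sup>2 * (?c\<^sup>2 * (2 * Suc q + 1)) =
      4 * ((2 * q + 1) * (2 * q + 3)) * (?b\<^sup>2 * (2 * q + 1))"
    by (simp only: power2_eq_square mult.assoc[symmetric]) (simp add: algebra_simps)
  also have "\<dots> \<le> 4 * (4 * (Suc q)\<^sup>2) * 16 ^ q"
  proof -
    have "(2 * q + 1) * (2 * q + 3) \<le> 4 * (Suc q)\<^sup>2"
      by (simp add: power2_eq_square algebra_simps)
    then show ?thesis using Suc.IH by (intro mult_le_mono[OF mult_le_mono[OF order_refl]])
  qed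
  also have "\<dots> = (Suc q)\<^sup>2 * 16 ^ Suc q" by simp
  finally show ?case by (simp only: mult_le_cancel1) simp
qed simp

section \<open>Greedy repair of the remaining conflicts\<close>

text \<open>Conflicts are removed one at a time by relabelling a vertex outside \<open>W\<close>;
  \<open>j\<close> bounds how many remain. A relabelling moves every sum by at most
  \<open>N\<close>, so lowering the tolerance from \<open>(j + 1) * N\<close> to
  \<open>j * N\<close> preserves the bound \<open>B\<close> on the far vectors within it.\<close>

lemma repair_labeling:
  fixes s :: "'p \<Rightarrow> 'a \<Rightarrow> int" and N \<theta> B :: nat
  assumes fin: "finite V" "finite P" and s: "\<And>p v. p \<in> P \<Longrightarrow> v \<in> V \<Longrightarrow> s p v \<in> {-1, 0, 1}"
    and close: "\<And>v. v \<in> V - W \<Longrightarrow> card {p \<in> P. close p \<and> s p v \<noteq> 0} \<le> \<theta>"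
    and N: "\<theta> + B < N"
    and "f ` V \<subseteq> {1..N}"
    and "\<And>p. p \<in> P \<Longrightarrow> (\<Sum>v\<in>V. s p v * int (f v)) = 0 \<Longrightarrow> \<exists>v\<in>V - W. s p v \<noteq> 0"
    and "card {p \<in> P. \<not> close p \<and> \<bar>\<Sum>v\<in>V. s p v * int (f v)\<bar> \<le> int j * int N} \<le> B"
    and "card {p \<in> P. (\<Sum>v\<in>V. s p v * int (f v)) = 0} \<le> j"
  shows "\<exists>g. g ` V \<subseteq> {1..N} \<and> (\<forall>p\<in>P. (\<Sum>v\<in>V. s p v * int (g v)) \<noteq> 0)"
  using assms(6-)
proof (induction j arbitrary: f)
  case 0
  then show ?case using fin by auto
next
  case (Suc j)
  let ?D = "\<lambda>f p. \<Sum>v\<in>V. s p v * int (f v)"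
  show ?case
  proof (cases "\<exists>p\<in>P. ?D f p = 0")
    case False
    then show ?thesis using Suc.prems(1) by blast
  next
    case True
    then obtain p v where p: "p \<in> P" "?D f p = 0" and v: "v \<in> V - W" "s p v \<noteq> 0"
      using Suc.prems(2) by blast
    have upd: "?D (f(v := y)) r = ?D f r + s r v * (int y - int (f v))" for y r
    proof -
      have "(\<Sum>u\<in>V - {v}. s r u * int ((f(v := y)) u)) = (\<Sum>u\<in>V - {v}. s r u * int (f u))"
        by (intro sum.cong) auto
      then show ?thesis using fin v(1) by (simp add: sum.remove[of V v] algebra_simps)
    qed
    have fv: "f v \<in> {1..N}" using Suc.prems(1) v by auto
    let ?Q1 = "{r \<in> P. close r \<and> s r v \<noteq> 0}"
    let ?Q2 = "{r \<in> P. \<not> close r \<and> \<bar>?D f r\<bar> \<le> int (Suc j) * int N}"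
    \<comment> \<open>Each \<open>r\<close> with \<open>s r v \<noteq> 0\<close> forbids at most one
      label of \<open>v\<close>, and only if its current sum is at most \<open>N\<close> in absolute
      value. Thus close vectors forbid at most \<open>\<theta>\<close> labels and far ones at most
      \<open>B\<close>.\<close>
    define F where "F = {y \<in> {1..N}. \<exists>r\<in>P. s r v \<noteq> 0 \<and> ?D (f(v := y)) r = 0}"
    have "F \<subseteq> (\<lambda>r. nat (int (f v) - s r v * ?D f r)) ` (?Q1 \<union> ?Q2)"
    proof
      fix y assume "y \<in> F"
      then obtain r where y: "y \<in> {1..N}" and r: "r \<in> P" "s r v \<noteq> 0" "?D (f(v := y)) r = 0"
        by (auto simp: F_def)
      have sr: "s r v = 1 \<or> s r v = -1" using s[OF r(1), of v] v r(2) by auto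
      have eq: "?D f r + s r v * (int y - int (f v)) = 0" using r(3) upd by simp
      then have yeq: "int y = int (f v) - s r v * ?D f r" using sr by auto
      have "\<bar>?D f r\<bar> \<le> int N" using eq sr y fv by auto
      also have "\<dots> \<le> int (Suc j) * int N" by (simp add: algebra_simps)
      finally have "r \<in> ?Q1 \<union> ?Q2" using r by auto
      moreover have "y = nat (int (f v) - s r v * ?D f r)" using yeq by linarith
      ultimately show "y \<in> (\<lambda>r. nat (int (f v) - s r v * ?D f r)) ` (?Q1 \<union> ?Q2)"
        by (rule rev_image_eqI)
    qed
    then have "card F \<le> card (?Q1 \<union> ?Q2)" using fin by (intro surj_card_le) auto
    also have "\<dots> \<le> card ?Q1 + card ?Q2" by (rule card_Un_le)
    also have "\<dots> < N" using close[OF v(1)] Suc.prems(3) N by linarith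
    finally have "card F < card {1..N}" by simp
    moreover have "F \<subseteq> {1..N}" by (auto simp: F_def)
    ultimately obtain y where y: "y \<in> {1..N}" "y \<notin> F" by (metis less_irrefl subset_antisym subsetI)
    let ?f = "f(v := y)"
    \<comment> \<open>A vector with sum zero after the change vanishes at \<open>v\<close> and had
      sum zero before. No conflict arises, and that of \<open>p\<close> is gone because
      \<open>s p v \<noteq> 0\<close>.\<close>
    have zero_old: "?D f r = 0 \<and> s r v = 0" if "r \<in> P" "?D ?f r = 0" for r
    proof -
      have "s r v = 0" using that y by (auto simp: F_def)
      then show ?thesis using that(2) upd by simp
    qed
    show ?thesis
    proof (rule Suc.IH[of ?f])
      show "?f ` V \<subseteq> {1..N}" using Suc.prems(1) y(1) by auto
      show "\<exists>u\<in>V - W. s r u \<noteq> 0" if "r \<in> P" "?D ?f r = 0" for r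
        using Suc.prems(2) zero_old that by blast
      have "\<bar>?D f r\<bar> \<le> int (Suc j) * int N" if "r \<in> P" "\<bar>?D ?f r\<bar> \<le> int j * int N" for r
      proof -
        have "\<bar>s r v * (int y - int (f v))\<bar> \<le> int N"
          using s[OF that(1), of v] v(1) y(1) fv by auto
        then show ?thesis using that(2) upd[of r y] by (simp add: algebra_simps)
      qed
      then have "{r \<in> P. \<not> close r \<and> \<bar>?D ?f r\<bar> \<le> int j * int N} \<subseteq> ?Q2" by blast
      then have "card {r \<in> P. \<not> close r \<and> \<bar>?D ?f r\<bar> \<le> int j * int N} \<le> card ?Q2"
        using fin by (intro card_mono) simp_all
      then show "card {r \<in> P. \<not> close r \<and> \<bar>?D ?f r\<bar> \<le> int j * int N} \<le> B"
        using Suc.prems(3) by (rule order_trans)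
      have "{r \<in> P. ?D ?f r = 0} \<subset> {r \<in> P. ?D f r = 0}"
        using zero_old p v(2) by blast
      then have "card {r \<in> P. ?D ?f r = 0} < card {r \<in> P. ?D f r = 0}"
        using fin by (intro psubset_card_mono) auto
      then show "card {r \<in> P. ?D ?f r = 0} \<le> j" using Suc.prems(4) by linarith
    qed
  qed
qed

section \<open>Averaging and the random labelling\<close>

text \<open>Markov's inequality for \<open>k\<close> quantities at once: the sum of the normalised
  \<open>x i w / b i\<close> has average at most \<open>k\<close>, so some \<open>w\<close> keeps
  it, and hence each summand, below \<open>k + 1\<close>.\<close>

lemma exists_below_averages:
  fixes x :: "nat \<Rightarrow> 'w \<Rightarrow> real"
  assumes fin: "finite \<Omega>" and ne: "\<Omega> \<noteq> {}"
    and nonneg: "\<And>i w. i < k \<Longrightarrow> w \<in> \<Omega> \<Longrightarrow> 0 \<le> x i w"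
    and b: "\<And>i. i < k \<Longrightarrow> 0 < b i"
    and avg: "\<And>i. i < k \<Longrightarrow> (\<Sum>w\<in>\<Omega>. x i w) \<le> b i * real (card \<Omega>)"
  obtains w where "w \<in> \<Omega>" "\<And>i. i < k \<Longrightarrow> x i w < real (k + 1) * b i"
proof -
  let ?\<Phi> = "\<lambda>w. \<Sum>i<k. x i w / b i"
  have \<Omega>: "real (card \<Omega>) > 0" using fin ne by (simp add: card_gt_0_iff)
  have "(\<Sum>w\<in>\<Omega>. ?\<Phi> w) = (\<Sum>i<k. (\<Sum>w\<in>\<Omega>. x i w) / b i)"
    by (subst sum.swap) (simp add: sum_divide_distrib)
  also have "\<dots> \<le> (\<Sum>i<k. real (card \<Omega>))"
    using avg b by (intro sum_mono) (simp add: divide_le_eq mult.commute)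
  also have "\<dots> < (\<Sum>w\<in>\<Omega>. real (k + 1))" using \<Omega> by (simp add: algebra_simps)
  finally have less: "(\<Sum>w\<in>\<Omega>. ?\<Phi> w) < (\<Sum>w\<in>\<Omega>. real (k + 1))" .
  obtain w where w: "w \<in> \<Omega>" "?\<Phi> w < real (k + 1)"
  proof (rule ccontr)
    assume "\<not> thesis"
    then have "(\<Sum>w\<in>\<Omega>. real (k + 1)) \<le> (\<Sum>w\<in>\<Omega>. ?\<Phi> w)"
      using that by (intro sum_mono) (meson not_le)
    then show False using less by linarith
  qed
  have "x i w < real (k + 1) * b i" if i: "i < k" for i
  proof -
    have "x i w / b i \<le> ?\<Phi> w"
      using i nonneg[OF _ w(1)] b by (intro member_le_sum) (auto intro: divide_nonneg_pos)
    then have "x i w / b i < real (k + 1)" using w(2) by linarith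
    then show ?thesis using b[OF i] by (simp add: divide_less_eq)
  qed
  then show thesis using that w(1) by blast
qed

lemma sum_card_le:
  assumes fin: "finite \<Omega>" "finite P" and K: "\<And>p. p \<in> P \<Longrightarrow> real (card {w \<in> \<Omega>. R w p}) \<le> K"
  shows "(\<Sum>w\<in>\<Omega>. real (card {p \<in> P. R w p})) \<le> real (card P) * K"
proof -
  have "(\<Sum>w\<in>\<Omega>. real (card {p \<in> P. R w p})) = (\<Sum>p\<in>P. real (card {w \<in> \<Omega>. R w p}))"
    using sum.swap_restrict[OF fin, of "\<lambda>_ _. 1::real" R] by simp
  also have "\<dots> \<le> (\<Sum>p\<in>P. K)" by (intro sum_mono K)
  finally show ?thesis by simp
qed

lemma card_filter_Times:
  assumes "finite A" "finite B"
  shows "card {w \<in> A \<times> B. R (fst w) (snd w)} = (\<Sum>a\<in>A. card {x \<in> B. R a x})"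
    and "card {w \<in> A \<times> B. R (fst w) (snd w)} = (\<Sum>x\<in>B. card {a \<in> A. R a x})"
proof -
  have "{w \<in> A \<times> B. R (fst w) (snd w)} = (SIGMA a : A. {x \<in> B. R a x})" by auto
  then show eq: "card {w \<in> A \<times> B. R (fst w) (snd w)} = (\<Sum>a\<in>A. card {x \<in> B. R a x})"
    using assms by simp
  then show "card {w \<in> A \<times> B. R (fst w) (snd w)} = (\<Sum>x\<in>B. card {a \<in> A. R a x})"
    using sum.swap_restrict[OF assms, of "\<lambda>_ _. 1::nat" R] by simp
qed

text \<open>The vectors \<^term>\<open>s p\<close> are the differences of the indicator functions of two edges.  With
  \<open>L = 48 c\<close>, the value of \<open>q\<close> is chosen so that \<open>16 c (2 L + 1) \<le> 1552 c\<^sup>2 = sqrt q\<close>, which beats the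
  bound \<open>4 ^ q / sqrt (2 q + 1)\<close> for the central binomial coefficient.\<close>

lemma exists_label_avoiding_sign_vectors:
  fixes s :: "'p \<Rightarrow> 'a \<Rightarrow> int" and c m q :: nat
  defines "q \<equiv> (1552 * c\<^sup>2)\<^sup>2"
  assumes fin: "finite V" "finite P"
    and s: "\<And>p v. p \<in> P \<Longrightarrow> v \<in> V \<Longrightarrow> s p v \<in> {-1, 0, 1}"
    and nz: "\<And>p. p \<in> P \<Longrightarrow> \<exists>v\<in>V. s p v \<noteq> 0"
    and cardP: "card P \<le> m\<^sup>2"
    and few: "\<And>W. W \<subseteq> V \<Longrightarrow> card {p \<in> P. \<forall>v\<in>V - W. s p v = 0} \<le> m * 2 ^ card W"
    and c: "1 \<le> c" and m: "16 * c * 2 ^ (8 * c * q) \<le> m"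
  shows "\<exists>f. f ` V \<subseteq> {1..m\<^sup>2 div c} \<and> (\<forall>p\<in>P. (\<Sum>v\<in>V. s p v * int (f v)) \<noteq> 0)"
proof -
  \<comment> \<open>Labels will have a low part in \<open>{1..M}\<close> plus possibly
    \<open>M\<close>, so they fit into \<open>{1..N}\<close>. As
    \<open>\<theta> + \<theta> < N\<close>, the repair can afford \<open>\<theta>\<close> labels
    forbidden by close vectors and \<open>\<theta>\<close> by far ones.\<close>
  define N where "N = m\<^sup>2 div c"
  define M where "M = N div 2"
  define \<theta> where "\<theta> = m\<^sup>2 div (4 * c)"
  \<comment> \<open>At most \<open>16 * c\<close> repairs are made, each moving a sum by at most
    \<open>N \<le> 3 * M\<close>, so \<open>L * M\<close> covers the total drift.\<close>
  define L where "L = 48 * c"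
  define close where "close p \<longleftrightarrow> card {v \<in> V. s p v \<noteq> 0} < 2 * q" for p
  define W where "W = {v \<in> V. m\<^sup>2 < 4 * c * card {p \<in> P. close p \<and> s p v \<noteq> 0}}"
  have "16 * c * 1 \<le> 16 * c * 2 ^ (8 * c * q)" by (intro mult_le_mono) auto
  then have m16: "16 * c \<le> m" using m by linarith
  then have "(16 * c) * 1 \<le> m * m" using c by (intro mult_le_mono) auto
  then have mm: "16 * c \<le> m\<^sup>2" by (simp add: power2_eq_square)
  have mpos: "0 < m" "0 < m\<^sup>2" using m16 c by auto
  have N1: "m\<^sup>2 < c * N + c"
    unfolding N_def using c dividend_less_times_div[of c "m\<^sup>2"] by simp
  have MN: "2 * M \<le> N" "N \<le> 2 * M + 1" unfolding M_def by linarith+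
  have "c * N \<le> c * (2 * M + 1)" using MN(2) by (rule mult_le_mono2)
  then have M4: "m\<^sup>2 \<le> 4 * c * M" using N1 mm by (simp add: algebra_simps)
  then have M: "0 < M" using mpos(2) by (cases "M = 0") auto
  have \<theta>4: "4 * c * \<theta> \<le> m\<^sup>2" unfolding \<theta>_def by (rule times_div_less_eq_dividend)
  have "4 * c * (\<theta> + \<theta>) = 2 * (4 * c * \<theta>)" "4 * c * N = 4 * (c * N)" by simp_all
  then have "4 * c * (\<theta> + \<theta>) < 4 * c * N" using \<theta>4 N1 mm by linarith
  then have \<theta>N: "\<theta> + \<theta> < N" by (simp only: mult_less_cancel1)
  have W: "W \<subseteq> V" "finite W" using fin by (auto simp: W_def)
  have le_\<theta>: "x \<le> \<theta>" if "4 * c * x \<le> m\<^sup>2" for x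
    using div_le_mono[OF that, of "4 * c"] c by (simp add: \<theta>_def)
  have close\<theta>: "card {p \<in> P. close p \<and> s p v \<noteq> 0} \<le> \<theta>" if "v \<in> V - W" for v
    using that by (intro le_\<theta>) (simp add: W_def not_less)
  \<comment> \<open>Double count incidences between heavy vertices and close vectors: a heavy vertex
    lies in more than \<open>m * m / (4 * c)\<close> supports, and each such support has fewer than
    \<open>2 * q\<close> elements.\<close>
  have cardW: "card W \<le> 8 * c * q"
  proof -
    let ?Pc = "{p \<in> P. close p}"
    have "card W * m\<^sup>2 = (\<Sum>v\<in>W. m\<^sup>2)" by simp
    also have "\<dots> \<le> (\<Sum>v\<in>W. 4 * c * card {p \<in> ?Pc. s p v \<noteq> 0})"
      by (intro sum_mono) (auto simp: W_def conj_assoc)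
    also have "\<dots> \<le> (\<Sum>v\<in>V. 4 * c * card {p \<in> ?Pc. s p v \<noteq> 0})"
      using fin W by (intro sum_mono2) auto
    also have "\<dots> = 4 * c * (\<Sum>p\<in>?Pc. card {v \<in> V. s p v \<noteq> 0})"
      using sum.swap_restrict[of V ?Pc "\<lambda>_ _. 1::nat" "\<lambda>v p. s p v \<noteq> 0"] fin
      by (simp flip: sum_distrib_left)
    also have "\<dots> \<le> 4 * c * (\<Sum>p\<in>?Pc. 2 * q)"
      by (intro mult_le_mono2 sum_mono) (auto simp: close_def)
    also have "\<dots> = 4 * c * (card ?Pc * (2 * q))" by simp
    also have "\<dots> \<le> 4 * c * (m\<^sup>2 * (2 * q))"
      using cardP card_mono[OF fin(2), of ?Pc] by (intro mult_le_mono2 mult_le_mono1) auto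
    also have "\<dots> = (8 * c * q) * m\<^sup>2" by simp
    finally show ?thesis using mpos(2) by (simp only: mult_le_cancel2)
  qed

  let ?A = "PiE V (\<lambda>_. {1..M})"
  let ?\<Omega> = "?A \<times> Pow V"
  let ?E = "\<lambda>p a X. \<Sum>v\<in>V. s p v * (int (a v) + int M * of_bool (v \<in> X))"
  let ?n = "card V"
  define \<delta> where "\<delta> = real ((2 * L + 1) * (2 * q choose q)) / 4 ^ q"
  have finA: "finite ?A" using fin by (intro finite_PiE) auto
  have fin\<Omega>: "finite ?\<Omega>" using finA fin by simp
  have cardA: "card ?A = M ^ ?n" using fin by (simp add: card_PiE)
  have card\<Omega>: "card ?\<Omega> = M ^ ?n * 2 ^ ?n"
    using fin by (simp only: card_cartesian_product cardA card_Pow)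
  have "card ?\<Omega> \<noteq> 0" unfolding card\<Omega> using M by simp
  then have ne\<Omega>: "?\<Omega> \<noteq> {}" by (rule contrapos_nn) (simp only: card.empty)
  \<comment> \<open>Here \<open>X\<close> is fixed and the low parts \<open>a\<close> are random;
    for far vectors below, \<open>a\<close> is fixed and \<open>X\<close> is random.\<close>
  have conflict: "real (card {w \<in> ?\<Omega>. ?E p (fst w) (snd w) = 0}) \<le> real (card ?\<Omega>) / real M"
    if p: "p \<in> P" for p
  proof -
    obtain v where v: "v \<in> V" "s p v \<noteq> 0" using nz[OF p] by blast
    have "card {w \<in> ?\<Omega>. ?E p (fst w) (snd w) = 0} * M = (\<Sum>X\<in>Pow V. card {a \<in> ?A. ?E p a X = 0} * M)"
      using card_filter_Times(2)[OF finA, of "Pow V" "\<lambda>a X. ?E p a X = 0"] fin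
      by (simp add: sum_distrib_right)
    also have "\<dots> \<le> (\<Sum>X\<in>Pow V. M ^ ?n)"
      by (intro sum_mono card_solutions_le[OF fin(1), of v] v)
    also have "\<dots> = card ?\<Omega>" unfolding card\<Omega> using fin by (simp add: card_Pow)
    finally have "real (card {w \<in> ?\<Omega>. ?E p (fst w) (snd w) = 0} * M) \<le> real (card ?\<Omega>)"
      by (simp only: of_nat_le_iff)
    then have "real (card {w \<in> ?\<Omega>. ?E p (fst w) (snd w) = 0}) * real M \<le> real (card ?\<Omega>)"
      by (simp only: of_nat_mult)
    then show ?thesis using M by (simp add: le_divide_eq)
  qed
  have near: "real (card {w \<in> ?\<Omega>. \<bar>?E p (fst w) (snd w)\<bar> \<le> int L * int M}) \<le> \<delta> * real (card ?\<Omega>)"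
    if p: "p \<in> P" "\<not> close p" for p
  proof -
    let ?K = "(2 * L + 1) * (2 * q choose q)"
    have q: "2 * q \<le> card {v \<in> V. s p v \<noteq> 0}" using p(2) by (simp add: close_def)
    have "card {w \<in> ?\<Omega>. \<bar>?E p (fst w) (snd w)\<bar> \<le> int L * int M} * 4 ^ q =
        (\<Sum>a\<in>?A. card {X \<in> Pow V. \<bar>?E p a X\<bar> \<le> int L * int M} * 4 ^ q)"
      using card_filter_Times(1)[OF finA, of "Pow V" "\<lambda>a X. \<bar>?E p a X\<bar> \<le> int L * int M"] fin
      by (simp add: sum_distrib_right)
    also have "\<dots> \<le> (\<Sum>a\<in>?A. ?K * 2 ^ ?n)"
      by (intro sum_mono card_near_le fin M q s[OF p(1)])
    also have "\<dots> = ?K * card ?\<Omega>" by (simp only: card\<Omega> sum_constant cardA ac_simps of_nat_id)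
    finally have "real (card {w \<in> ?\<Omega>. \<bar>?E p (fst w) (snd w)\<bar> \<le> int L * int M} * 4 ^ q)
        \<le> real (?K * card ?\<Omega>)"
      by (simp only: of_nat_le_iff)
    then have "real (card {w \<in> ?\<Omega>. \<bar>?E p (fst w) (snd w)\<bar> \<le> int L * int M}) * 4 ^ q
        \<le> real ?K * real (card ?\<Omega>)"
      by (simp only: of_nat_mult of_nat_power of_nat_numeral)
    then show ?thesis by (simp add: \<delta>_def le_divide_eq)
  qed

  \<comment> \<open>The three counts are all conflicts, the conflicts supported on the heavy set
    \<open>W\<close>, and the far vectors with sum near zero; \<open>b\<close> bounds their
    expectations.\<close>
  define x where "x i w = real (card
      (if i = 0 then {p \<in> P. ?E p (fst w) (snd w) = 0}
       else if i = 1 then {p \<in> {p \<in> P. \<forall>v\<in>V - W. s p v = 0}. ?E p (fst w) (snd w) = 0}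
       else {p \<in> {p \<in> P. \<not> close p}. \<bar>?E p (fst w) (snd w)\<bar> \<le> int L * int M}))"
    for i :: nat and w
  define b where "b i = (if i = 0 then (real m)\<^sup>2 / real M
       else if i = 1 then real m * 2 ^ (8 * c * q) / real M else (real m)\<^sup>2 * \<delta>)" for i :: nat
  have \<delta>pos: "0 < \<delta>"
    unfolding \<delta>_def of_nat_mult by (intro divide_pos_pos mult_pos_pos) (simp_all add: zero_less_binomial)
  have cardPr: "real (card P) \<le> (real m)\<^sup>2" using cardP by (simp flip: of_nat_power)
  have avg: "(\<Sum>w\<in>?\<Omega>. x i w) \<le> b i * real (card ?\<Omega>)" for i
  proof -
    consider "i = 0" | "i = 1" | "i \<noteq> 0" "i \<noteq> 1" by blast
    then show ?thesis
    proof cases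
      case 1
      have "(\<Sum>w\<in>?\<Omega>. x i w) \<le> real (card P) * (real (card ?\<Omega>) / real M)"
        using sum_card_le[OF fin\<Omega> fin(2), of "\<lambda>w p. ?E p (fst w) (snd w) = 0", OF conflict]
        by (simp add: x_def 1)
      also have "\<dots> \<le> (real m)\<^sup>2 * (real (card ?\<Omega>) / real M)"
        using cardPr by (intro mult_right_mono) auto
      finally show ?thesis by (simp add: b_def 1)
    next
      case 2
      let ?P = "{p \<in> P. \<forall>v\<in>V - W. s p v = 0}"
      have "card ?P \<le> m * 2 ^ card W" by (rule few[OF W(1)])
      also have "\<dots> \<le> m * 2 ^ (8 * c * q)"
        using cardW by (intro mult_le_mono2 power_increasing) simp_all
      finally have "card ?P \<le> m * 2 ^ (8 * c * q)" .
      then have "real (card ?P) \<le> real (m * 2 ^ (8 * c * q))" by (simp only: of_nat_le_iff)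
      then have P: "real (card ?P) \<le> real m * 2 ^ (8 * c * q)"
        by (simp only: of_nat_mult of_nat_power of_nat_numeral)
      have "(\<Sum>w\<in>?\<Omega>. x i w) \<le> real (card ?P) * (real (card ?\<Omega>) / real M)"
      proof -
        have "(\<Sum>w\<in>?\<Omega>. real (card {p \<in> ?P. ?E p (fst w) (snd w) = 0}))
            \<le> real (card ?P) * (real (card ?\<Omega>) / real M)"
          using fin(2) by (intro sum_card_le[OF fin\<Omega>] conflict) simp_all
        then show ?thesis by (simp add: x_def 2)
      qed
      also have "\<dots> \<le> real m * 2 ^ (8 * c * q) * (real (card ?\<Omega>) / real M)"
        using P by (intro mult_right_mono) auto
      finally show ?thesis by (simp add: b_def 2)
    next
      case 3
      let ?P = "{p \<in> P. \<not> close p}"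
      have P: "real (card ?P) \<le> (real m)\<^sup>2"
      proof -
        have "card ?P \<le> card P" using fin(2) by (intro card_mono) auto
        then show ?thesis using cardPr by linarith
      qed
      have "(\<Sum>w\<in>?\<Omega>. x i w) \<le> real (card ?P) * (\<delta> * real (card ?\<Omega>))"
      proof -
        have "(\<Sum>w\<in>?\<Omega>. real (card {p \<in> ?P. \<bar>?E p (fst w) (snd w)\<bar> \<le> int L * int M}))
            \<le> real (card ?P) * (\<delta> * real (card ?\<Omega>))"
          using fin(2) by (intro sum_card_le[OF fin\<Omega>] near) simp_all
        then show ?thesis using 3 by (simp add: x_def)
      qed
      also have "\<dots> \<le> (real m)\<^sup>2 * (\<delta> * real (card ?\<Omega>))"
        using P \<delta>pos by (intro mult_right_mono) auto
      finally show ?thesis using 3 by (simp add: b_def)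
    qed
  qed
  have "0 < b i" for i using mpos M \<delta>pos by (auto simp: b_def)
  then obtain w where w: "w \<in> ?\<Omega>" "\<And>i. i < 3 \<Longrightarrow> x i w < real (3 + 1) * b i"
    using exists_below_averages[OF fin\<Omega> ne\<Omega>, of 3 x b] avg by (auto simp: x_def)
  obtain a X where aX: "w = (a, X)" by (cases w)
  have a: "a \<in> ?A" and X: "X \<subseteq> V" using w(1) aX by auto
  define f where "f v = a v + M * of_bool (v \<in> X)" for v
  have Df: "?E p a X = (\<Sum>v\<in>V. s p v * int (f v))" for p by (simp add: f_def)

  have f: "f ` V \<subseteq> {1..N}"
  proof (rule image_subsetI)
    fix v assume "v \<in> V"
    then have "a v \<in> {1..M}" using a by auto
    then show "f v \<in> {1..N}" using MN(1) by (auto simp: f_def)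
  qed
  have x0: "card {p \<in> P. (\<Sum>v\<in>V. s p v * int (f v)) = 0} \<le> 16 * c"
  proof -
    have "real (m\<^sup>2) \<le> real (4 * c * M)" using M4 by (simp only: of_nat_le_iff)
    then have "4 * ((real m)\<^sup>2 / real M) \<le> real (16 * c)" using M by (simp add: divide_le_eq ac_simps)
    then show ?thesis using w(2)[of 0] by (simp add: x_def b_def aX Df)
  qed
  \<comment> \<open>The size of \<open>m\<close> pushes the bound for conflicts inside
    \<open>W\<close> to at most 1. The count is an integer strictly below it, hence zero.\<close>
  have x1: "\<exists>v\<in>V - W. s p v \<noteq> 0" if p: "p \<in> P" "(\<Sum>v\<in>V. s p v * int (f v)) = 0" for p
  proof (rule ccontr)
    assume "\<not> ?thesis"
    then have "p \<in> {p \<in> {p \<in> P. \<forall>v\<in>V - W. s p v = 0}. (\<Sum>v\<in>V. s p v * int (f v)) = 0}"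
      using p by auto
    then have "card {p \<in> {p \<in> P. \<forall>v\<in>V - W. s p v = 0}. (\<Sum>v\<in>V. s p v * int (f v)) = 0} \<noteq> 0"
      using fin(2) by (auto simp: card_eq_0_iff)
    then have "1 \<le> x 1 w" by (simp add: x_def aX Df)
    moreover have "4 * (real m * 2 ^ (8 * c * q) / real M) \<le> 1"
    proof -
      have "4 * c * (4 * (m * 2 ^ (8 * c * q))) = m * (16 * c * 2 ^ (8 * c * q))" by simp
      also have "\<dots> \<le> m * m" using m by (rule mult_le_mono2)
      also have "\<dots> \<le> 4 * c * M" using M4 by (simp add: power2_eq_square)
      finally have "4 * (m * 2 ^ (8 * c * q)) \<le> M" using c by simp
      then have "real (4 * (m * 2 ^ (8 * c * q))) \<le> real M" by (simp only: of_nat_le_iff)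
      then show ?thesis using M by (simp add: divide_le_eq)
    qed
    ultimately show False using w(2)[of 1] by (simp add: b_def)
  qed
  have x2: "card {p \<in> P. \<not> close p \<and> \<bar>\<Sum>v\<in>V. s p v * int (f v)\<bar> \<le> int (16 * c) * int N} \<le> \<theta>"
    (is "card ?S \<le> \<theta>")
  proof -
    let ?S' = "{p \<in> {p \<in> P. \<not> close p}. \<bar>\<Sum>v\<in>V. s p v * int (f v)\<bar> \<le> int L * int M}"
    have "16 * c * N \<le> 16 * c * (3 * M)" using MN(2) M by (intro mult_le_mono2) linarith
    also have "\<dots> = L * M" by (simp add: L_def)
    finally have "int (16 * c) * int N \<le> int L * int M"
      by (simp only: of_nat_le_iff flip: of_nat_mult)
    then have "?S \<subseteq> ?S'" by (blast intro: order_trans)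
    then have "card ?S \<le> card ?S'" using fin by (intro card_mono) auto
    then have "real (card ?S) \<le> real (card ?S')" by (simp only: of_nat_le_iff)
    also have "real (card ?S') < 4 * ((real m)\<^sup>2 * \<delta>)"
      using w(2)[of 2] by (simp add: x_def b_def aX Df)
    finally have S: "real (card ?S) < 4 * ((real m)\<^sup>2 * \<delta>)" .
    have "(1552 * c\<^sup>2 * (2 * q choose q))\<^sup>2 = (2 * q choose q)\<^sup>2 * q"
      by (simp add: q_def power_mult_distrib)
    also have "\<dots> \<le> (2 * q choose q)\<^sup>2 * (2 * q + 1)" by (intro mult_le_mono2) simp
    also have "\<dots> \<le> 16 ^ q" by (rule central_binomial_sq_le)
    also have "(16::nat) ^ q = (4 ^ q)\<^sup>2" by (simp add: power2_eq_square flip: power_mult_distrib)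
    finally have "1552 * c\<^sup>2 * (2 * q choose q) \<le> 4 ^ q" by (simp only: power2_nat_le_eq_le)
    moreover have "16 * c * (2 * L + 1) \<le> 1552 * c\<^sup>2"
      using c by (simp add: L_def power2_eq_square algebra_simps)
    ultimately have "16 * c * (2 * L + 1) * (2 * q choose q) \<le> 4 ^ q"
      using mult_le_mono1[of "16 * c * (2 * L + 1)" "1552 * c\<^sup>2" "2 * q choose q"] by linarith
    then have "real (16 * c * (2 * L + 1) * (2 * q choose q)) \<le> real (4 ^ q)"
      by (simp only: of_nat_le_iff)
    then have "real (16 * c * (2 * L + 1) * (2 * q choose q)) / 4 ^ q \<le> 1"
      by (simp add: divide_le_eq)
    also have "real (16 * c * (2 * L + 1) * (2 * q choose q)) / 4 ^ q = 16 * real c * \<delta>"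
      unfolding \<delta>_def by (simp only: of_nat_mult times_divide_eq_right of_nat_numeral mult.assoc)
    finally have "16 * real c * \<delta> \<le> 1" .
    then have "(real m)\<^sup>2 * (16 * real c * \<delta>) \<le> (real m)\<^sup>2 * 1" by (intro mult_left_mono) auto
    moreover have "4 * real c * real (card ?S) \<le> 4 * real c * (4 * ((real m)\<^sup>2 * \<delta>))"
      using S by (intro mult_left_mono) auto
    ultimately have "4 * real c * real (card ?S) \<le> (real m)\<^sup>2"
      by (simp add: algebra_simps)
    then have "real (4 * c * card ?S) \<le> real (m\<^sup>2)" by simp
    then show ?thesis by (intro le_\<theta>) (simp only: of_nat_le_iff)
  qed
  \<comment> \<open>The repair runs with \<open>j = 16 * c\<close> and
    \<open>B = \<theta>\<close>.\<close>
  show ?thesis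
    using repair_labeling[OF fin s close\<theta> \<theta>N f x1 x2 x0] unfolding N_def .
qed

section \<open>From sign vectors to hypergraphs, and both bounds together\<close>

text \<open>A labelling distinguishes \<open>E\<close> iff it is orthogonal to no difference of
  indicator functions of two distinct edges, so the result on sign vectors applies to the ordered
  pairs of distinct edges.\<close>

lemma label_number_le:
  assumes hyp: "hypergraph V E" and cE: "card E = m" and c: "1 \<le> c"
    and m: "16 * c * 2 ^ (8 * c * (1552 * c\<^sup>2)\<^sup>2) \<le> m"
  shows "label_number V E \<le> m\<^sup>2 div c"
proof -
  have finV: "finite V" and EV: "E \<subseteq> Pow V" using hyp by (auto simp: hypergraph_def)
  have finE: "finite E" using finV EV by (meson finite_Pow_iff finite_subset)
  define P where "P = {(e, e') \<in> E \<times> E. e \<noteq> e'}"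
  define s :: "'a set \<times> 'a set \<Rightarrow> 'a \<Rightarrow> int"
    where "s p v = of_bool (v \<in> fst p) - of_bool (v \<in> snd p)" for p v
  have s0: "s p v = 0 \<longleftrightarrow> (v \<in> fst p \<longleftrightarrow> v \<in> snd p)" for p v by (simp add: s_def)
  have finP: "finite P" using finE by (auto simp: P_def intro: finite_subset[of _ "E \<times> E"])
  have "card P \<le> card (E \<times> E)" using finE by (intro card_mono) (auto simp: P_def)
  then have cP: "card P \<le> m\<^sup>2" by (simp add: card_cartesian_product cE power2_eq_square)
  have nz: "\<exists>v\<in>V. s p v \<noteq> 0" if "p \<in> P" for p
  proof (rule ccontr)
    assume "\<not> ?thesis"
    then have "\<forall>v\<in>V. v \<in> fst p \<longleftrightarrow> v \<in> snd p" by (simp add: s0)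
    moreover have "fst p \<in> Pow V" "snd p \<in> Pow V" "fst p \<noteq> snd p"
      using that subsetD[OF EV] by (simp_all add: P_def case_prod_beta mem_Times_iff)
    ultimately show False by blast
  qed
  \<comment> \<open>The two edges agree outside \<open>W\<close>, so the second is determined by the
    first and by its own trace on \<open>W\<close>.\<close>
  have few: "card {p \<in> P. \<forall>v\<in>V - W. s p v = 0} \<le> m * 2 ^ card W" if W: "W \<subseteq> V" for W
  proof -
    let ?Q = "{p \<in> P. \<forall>v\<in>V - W. s p v = 0}"
    have finW: "finite W" using W finV by (rule finite_subset)
    have "inj_on (\<lambda>p. (fst p, snd p \<inter> W)) ?Q"
    proof (rule inj_onI)
      fix p p' assume p: "p \<in> ?Q" "p' \<in> ?Q" and eq: "(fst p, snd p \<inter> W) = (fst p', snd p' \<inter> W)"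
      have "snd p \<in> E" "snd p' \<in> E" using p by (auto simp: P_def)
      then have sub: "snd p \<subseteq> V" "snd p' \<subseteq> V" using EV by auto
      have "v \<in> snd p \<longleftrightarrow> v \<in> snd p'" if "v \<in> V" for v
        using p eq that unfolding s0 by (cases "v \<in> W") auto
      then have "snd p = snd p'" using sub by blast
      then show "p = p'" using eq by (simp add: prod_eq_iff)
    qed
    moreover have "(\<lambda>p. (fst p, snd p \<inter> W)) ` ?Q \<subseteq> E \<times> Pow W" by (auto simp: P_def)
    moreover have "finite (E \<times> Pow W)" using finE finW by simp
    ultimately have "card ?Q \<le> card (E \<times> Pow W)" by (rule card_inj_on_le)
    then show ?thesis using finW by (simp add: card_cartesian_product card_Pow cE)
  qed
  have s_range: "s p v \<in> {-1, 0, 1}" for p v by (simp add: s_def)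
  have "\<exists>f. f ` V \<subseteq> {1..m\<^sup>2 div c} \<and> (\<forall>p\<in>P. (\<Sum>v\<in>V. s p v * int (f v)) \<noteq> 0)"
    by (rule exists_label_avoiding_sign_vectors[OF finV finP s_range nz cP few c m])
  then obtain f where f: "f ` V \<subseteq> {1..m\<^sup>2 div c}"
    and ne: "\<And>p. p \<in> P \<Longrightarrow> (\<Sum>v\<in>V. s p v * int (f v)) \<noteq> 0"
    by blast
  have "(\<Sum>v\<in>e. f v) \<noteq> (\<Sum>v\<in>e'. f v)" if e: "e \<in> E" "e' \<in> E" "e \<noteq> e'" for e e'
  proof -
    have sum: "(\<Sum>v\<in>V. of_bool (v \<in> e) * int (f v)) = int (\<Sum>v\<in>e. f v)" if "e \<in> E" for e
    proof -
      have "(\<Sum>v\<in>V. of_bool (v \<in> e) * int (f v)) = (\<Sum>v\<in>e. int (f v))"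
        using finV EV that by (intro sum.mono_neutral_cong_right) auto
      then show ?thesis by simp
    qed
    have "(\<Sum>v\<in>V. s (e, e') v * int (f v)) = int (\<Sum>v\<in>e. f v) - int (\<Sum>v\<in>e'. f v)"
      using sum[OF e(1)] sum[OF e(2)] by (simp only: s_def fst_conv snd_conv left_diff_distrib sum_subtractf)
    moreover have "(e, e') \<in> P" using e by (simp add: P_def)
    ultimately have "int (\<Sum>v\<in>e. f v) - int (\<Sum>v\<in>e'. f v) \<noteq> 0" using ne by metis
    then show ?thesis by (rule contrapos_nn) (simp only: diff_self)
  qed
  then have "sum_distinguishing E f" unfolding sum_distinguishing_def by blast
  with f have "\<exists>f. f ` V \<subseteq> {1..m\<^sup>2 div c} \<and> sum_distinguishing E f" by blast
  then show ?thesis unfolding label_number_def by (rule Least_le)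
qed

text \<open>The bound holds for each hypergraph separately; \<open>m \<le> 2 ^ n\<close> ensures
  that one with these parameters exists, so the maximum is over a nonempty set.\<close>

lemma max_label_number_upper:
  assumes c: "1 \<le> c" and m: "16 * c * 2 ^ (8 * c * (1552 * c\<^sup>2)\<^sup>2) \<le> m" and mn: "m \<le> 2 ^ n"
  shows "max_label_number n m \<le> m\<^sup>2 div c"
  unfolding max_label_number_def
proof (rule Max.boundedI[OF finite_label_numbers label_numbers_nonempty[OF mn]])
  fix l
  assume "l \<in> {label_number V E | (V :: nat set) E. hypergraph V E \<and> card V = n \<and> card E = m}"
  then obtain V :: "nat set" and E where "l = label_number V E" "hypergraph V E" "card E = m"
    by blast
  then show "l \<le> m\<^sup>2 div c" using label_number_le[OF _ _ c m] by blast
qed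

theorem theorem1:
  "\<forall>C::real>0. \<forall>\<epsilon>::real>0. \<exists>n0::nat. \<forall>n::nat>n0. \<forall>m::nat.
     n \<le> m \<and> real m \<le> real n powr (1 / \<epsilon>) \<longrightarrow>
     real m powr (2 - \<epsilon>) \<le> real (max_label_number n m) \<and>
     real (max_label_number n m) \<le> (real m)\<^sup>2 / C"
proof (intro allI impI)
  fix C \<epsilon> :: real
  assume C: "0 < C" and eps: "0 < \<epsilon>"
  define c where "c = nat \<lceil>C\<rceil>"
  \<comment> \<open>The lower bound requires an exponent parameter below 1. Shrinking
    \<open>\<epsilon>\<close> to \<open>\<eta>\<close> enlarges the admissible range of
    \<open>m\<close> and only strengthens the conclusion.\<close>
  define \<eta> where "\<eta> = min \<epsilon> (1 / 2)"
  have c: "1 \<le> c" "C \<le> real c" using C unfolding c_def by linarith+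
  have \<eta>: "0 < \<eta>" "\<eta> < 1" "\<eta> \<le> \<epsilon>" using eps by (auto simp: \<eta>_def)
  obtain n1 where n1: "\<And>n m. n1 < n \<Longrightarrow> n \<le> m \<Longrightarrow> real m \<le> real n powr (1 / \<eta>) \<Longrightarrow>
      real m powr (2 - \<eta>) \<le> real (max_label_number n m)"
    using max_label_number_lower[OF \<eta>(1,2)] by blast
  \<comment> \<open>This yields \<open>m \<le> 2 ^ n\<close> for large \<open>n\<close>, as the
    upper bound requires.\<close>
  have "\<forall>\<^sub>F x :: real in at_top. x powr (1 / \<epsilon>) \<le> 2 powr x"
    using eps by real_asymp
  then obtain x0 :: real where x0: "\<And>x. x \<ge> x0 \<Longrightarrow> x powr (1 / \<epsilon>) \<le> 2 powr x"
    unfolding eventually_at_top_linorder by blast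
  let ?m0 = "16 * c * 2 ^ (8 * c * (1552 * c\<^sup>2)\<^sup>2)"
  show "\<exists>n0. \<forall>n>n0. \<forall>m. n \<le> m \<and> real m \<le> real n powr (1 / \<epsilon>) \<longrightarrow>
     real m powr (2 - \<epsilon>) \<le> real (max_label_number n m) \<and>
     real (max_label_number n m) \<le> (real m)\<^sup>2 / C"
  proof (intro exI[of _ "max (max n1 ?m0) (nat \<lceil>x0\<rceil>)"] allI impI)
    fix n m :: nat
    assume "max (max n1 ?m0) (nat \<lceil>x0\<rceil>) < n" and nm: "n \<le> m \<and> real m \<le> real n powr (1 / \<epsilon>)"
    then have n: "n1 < n" "?m0 < n" "nat \<lceil>x0\<rceil> < n" by simp_all
    have xn: "x0 \<le> real n" using n(3) by linarith
    have n_ge: "1 \<le> real n" "1 \<le> real m" using n(1) nm by simp_all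
    have "real m \<le> real n powr (1 / \<eta>)"
    proof -
      have "real n powr (1 / \<epsilon>) \<le> real n powr (1 / \<eta>)"
        using n_ge \<eta> by (intro powr_mono divide_left_mono) auto
      then show ?thesis using nm by linarith
    qed
    then have "real m powr (2 - \<eta>) \<le> real (max_label_number n m)" using n1 n(1) nm by blast
    moreover have "real m powr (2 - \<epsilon>) \<le> real m powr (2 - \<eta>)"
      using n_ge \<eta> by (intro powr_mono) auto
    ultimately have lower: "real m powr (2 - \<epsilon>) \<le> real (max_label_number n m)" by linarith
    have "real m \<le> 2 powr real n" using nm x0[OF xn] by linarith
    then have "real m \<le> real (2 ^ n)" by (simp add: powr_realpow)
    then have "m \<le> 2 ^ n" by (simp only: of_nat_le_iff)
    moreover have "?m0 \<le> m" using n(2) nm by linarith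
    ultimately have "max_label_number n m \<le> m\<^sup>2 div c" using max_label_number_upper[OF c(1)] by blast
    then have "real (max_label_number n m) \<le> real (m\<^sup>2 div c)" by (simp only: of_nat_le_iff)
    also have "\<dots> \<le> real (m\<^sup>2) / real c" by (rule of_nat_div_le_of_nat)
    also have "\<dots> \<le> (real m)\<^sup>2 / C" using c C by (simp add: divide_left_mono)
    finally show "real m powr (2 - \<epsilon>) \<le> real (max_label_number n m) \<and>
        real (max_label_number n m) \<le> (real m)\<^sup>2 / C" using lower by blast
  qed
qed

end
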